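(* Let $[a,b]\subset[0,\infty)$ with $a<b$, let $\alpha>0$, and let $f:[a,b]\to\mathbb{R}$ be differentiable on $(a,b)$ with $f'\in L[a,b]$. If $|f'|^{q}$ is $s$-convex in the second sense on $[a,b]$ for some fixed $s\in(0,1)$ and $q\ge 1$, then $$\left|\frac{f(a)+f(b)}{2}-\frac{\Gamma(\alpha+1)}{2(b-a)^{\alpha}}\left[J_{a+}^{\alpha}f(b)+J_{b-}^{\alpha}f(a)\right]\right|$$ $$\le \frac{b-a}{2}\left[\frac{2}{\alpha+1}\left(1-\frac{1}{2^{\alpha}}\right)\right]^{\frac{q-1}{q}}\left\{\beta\left(\tfrac12;s+1,\alpha+1\right)-\beta\left(\tfrac12;\alpha+1,s+1\right)+\frac{2^{\alpha+s}-1}{(\alpha+s+1)2^{\alpha+s}}\right\}^{\frac1q}\left(|f'(a)|^{q}+|f'(b)|^{q}\right)^{\frac1q}.$$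
   Context: A function $g$ is $s$-convex in the second sense on $[a,b]\subset[0,\infty)$, for a fixed $s\in(0,1]$, if $g(\lambda x+(1-\lambda)y)\le \lambda^{s}g(x)+(1-\lambda)^{s}g(y)$ for all $x,y\in[a,b]$ and $\lambda\in[0,1]$. The hypothesis that $|f'|^q$ is $s$-convex on $[a,b]$ presupposes that $f'$ is defined on all of $[a,b]$, with $f'(a)$ and $f'(b)$ being the one-sided derivatives. For $f\in L_1[a,b]$ with $a\ge 0$ and $\alpha>0$, the Riemann-Liouville fractional integrals are $$J_{a+}^{\alpha}f(x)=\frac{1}{\Gamma(\alpha)}\int_a^x (x-t)^{\alpha-1}f(t)\,dt\ (x>a),\qquad J_{b-}^{\alpha}f(x)=\frac{1}{\Gamma(\alpha)}\int_x^b (t-x)^{\alpha-1}f(t)\,dt\ (x<b),$$ where $\Gamma$ is the Gamma function. $\beta(z;x,y)=\int_0^{z} t^{x-1}(1-t)^{y-1}\,dt$ is the incomplete Beta function. *)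

theory Defs
  imports "HOL-Analysis.Analysis"
begin

text \<open>
  Powers with real exponents are rendered by \<open>powr\<close>, for which \<open>0 powr x = 0\<close> for every \<open>x\<close>.
  In \<open>s_convex_on\<close> this agrees with the usual convention because \<open>s > 0\<close> in all uses; in the
  integrals below it affects the integrand at the end points only.
\<close>

definition s_convex_on :: "real \<Rightarrow> real set \<Rightarrow> (real \<Rightarrow> real) \<Rightarrow> bool" where
  "s_convex_on s S g \<longleftrightarrow>
     (\<forall>x\<in>S. \<forall>y\<in>S. \<forall>u\<in>{0..1}.
        g (u * x + (1 - u) * y) \<le> u powr s * g x + (1 - u) powr s * g y)"

definition RL_integral_left :: "real \<Rightarrow> real \<Rightarrow> (real \<Rightarrow> real) \<Rightarrow> real \<Rightarrow> real" where
  "RL_integral_left \<alpha> a f x =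
     1 / Gamma \<alpha> * (LINT t:{a..x}|lebesgue. (x - t) powr (\<alpha> - 1) * f t)"

definition RL_integral_right :: "real \<Rightarrow> real \<Rightarrow> (real \<Rightarrow> real) \<Rightarrow> real \<Rightarrow> real" where
  "RL_integral_right \<alpha> b f x =
     1 / Gamma \<alpha> * (LINT t:{x..b}|lebesgue. (t - x) powr (\<alpha> - 1) * f t)"

definition incomplete_Beta :: "real \<Rightarrow> real \<Rightarrow> real \<Rightarrow> real" where
  "incomplete_Beta z x y =
     (LINT t:{0..z}|lebesgue. t powr (x - 1) * (1 - t) powr (y - 1))"

end

theory Submission
  imports Defs
begin

text \<open>
  Put \<open>g(x) = (x - a)\<^sup>\<alpha> - (b - x)\<^sup>\<alpha>\<close>. Since \<open>g(b) = -g(a) = (b - a)\<^sup>\<alpha>\<close>, integrating \<open>f' g\<close> by parts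
  produces the trapezoidal mean of \<open>f\<close> as boundary term and the two fractional integrals as
  remaining integral, so the quantity to be estimated is
  \<open>\<bar>\<integral> f' g\<bar> / (2 (b - a)\<^sup>\<alpha>)\<close> (\<open>has_integral_trapezoid_RL\<close>).

  With \<open>u = (x - a) / (b - a)\<close>, \<open>s\<close>-convexity bounds \<open>\<bar>f' x\<bar>\<^sup>q\<close> by
  \<open>u\<^sup>s B + (1 - u)\<^sup>s A\<close>, where \<open>A = \<bar>f' a\<bar>\<^sup>q\<close> and \<open>B = \<bar>f' b\<bar>\<^sup>q\<close>. The power-mean inequality
  would now bound \<open>\<integral> \<bar>f'\<bar> \<bar>g\<bar>\<close>; it is used in its linearised form, Young's inequality
  \<open>y \<le> (1 - 1/q) m + (1/q) m\<^bsup>1-q\<^esup> y\<^sup>q\<close>, integrated against \<open>\<bar>g\<bar>\<close> and optimised over \<open>m > 0\<close> only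
  at the end (\<open>powr_mean_from_linear_bounds\<close>). The dominating functions to be integrated
  are then explicit in \<open>u\<close>.

  The weight \<open>\<bar>u\<^sup>\<alpha> - (1 - u)\<^sup>\<alpha>\<bar>\<close> is symmetric about \<open>1/2\<close>. Folding the unit interval there
  removes the absolute value and replaces \<open>u\<^sup>s B + (1 - u)\<^sup>s A\<close> by \<open>(A + B) (u\<^sup>s + (1 - u)\<^sup>s)\<close>,
  which is why the final bound depends on \<open>f' a\<close> and \<open>f' b\<close> only through \<open>A + B\<close>; the resulting
  integrals over \<open>[0, 1/2]\<close> are the two incomplete Beta values and elementary powers
  (\<open>has_integral_kernel_s_convex_bound\<close>).
\<close>

section \<open>The trapezoidal defect as an integral of the derivative\<close>

lemma has_integral_powr_from_left:
  fixes a b \<alpha> :: real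
  assumes "a \<le> b" "0 < \<alpha>"
  shows "((\<lambda>x. \<alpha> * (x - a) powr (\<alpha> - 1)) has_integral (b - a) powr \<alpha>) {a..b}"
proof -
  have "((\<lambda>x. \<alpha> * (x - a) powr (\<alpha> - 1)) has_integral (b - a) powr \<alpha> - (a - a) powr \<alpha>) {a..b}"
    using assms
    by (intro fundamental_theorem_of_calculus_interior)
       (auto intro!: continuous_intros continuous_on_powr' derivative_eq_intros
             simp flip: has_real_derivative_iff_has_vector_derivative)
  then show ?thesis by simp
qed

lemma has_integral_powr_from_right:
  fixes a b \<alpha> :: real
  assumes "a \<le> b" "0 < \<alpha>"
  shows "((\<lambda>x. \<alpha> * (b - x) powr (\<alpha> - 1)) has_integral (b - a) powr \<alpha>) {a..b}"
proof -
  have "((\<lambda>x. \<alpha> * (b - x) powr (\<alpha> - 1)) has_integral - ((b - b) powr \<alpha>) - (- ((b - a) powr \<alpha>))) {a..b}"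
    using assms
    by (intro fundamental_theorem_of_calculus_interior)
       (auto intro!: continuous_intros continuous_on_powr' derivative_eq_intros
             simp flip: has_real_derivative_iff_has_vector_derivative)
  then show ?thesis by simp
qed

lemma absolutely_integrable_continuous_mult_nonneg:
  fixes f h :: "real \<Rightarrow> real"
  assumes "continuous_on {a..b} f" "h integrable_on {a..b}" "\<And>x. x \<in> {a..b} \<Longrightarrow> 0 \<le> h x"
  shows "(\<lambda>x. f x * h x) absolutely_integrable_on {a..b}"
proof (rule absolutely_integrable_bounded_measurable_product_real)
  show "f \<in> borel_measurable (lebesgue_on {a..b})"
    using assms(1) by (rule continuous_imp_measurable_on_sets_lebesgue) simp
  show "bounded (f ` {a..b})"
    using assms(1) by (simp add: compact_continuous_image compact_imp_bounded)
  show "h absolutely_integrable_on {a..b}"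
    using assms(2,3) by (rule nonnegative_absolutely_integrable_1)
qed simp

text \<open>
  The fractional integrals are Lebesgue integrals, whereas integration by parts takes place in the
  Henstock-Kurzweil sense; the two agree because the kernels are nonnegative and integrable, even
  where they are singular, and \<open>f\<close> is bounded.
\<close>

lemma RL_integral_left_has_integral:
  fixes f :: "real \<Rightarrow> real"
  assumes "a \<le> b" "0 < \<alpha>" "continuous_on {a..b} f"
  shows "((\<lambda>x. f x * (\<alpha> * (b - x) powr (\<alpha> - 1))) has_integral
           Gamma (\<alpha> + 1) * RL_integral_left \<alpha> a f b) {a..b}"
proof -
  have "(\<lambda>x. f x * (\<alpha> * (b - x) powr (\<alpha> - 1))) absolutely_integrable_on {a..b}"
    using has_integral_powr_from_right[OF assms(1,2)] assms
    by (intro absolutely_integrable_continuous_mult_nonneg) (auto simp: integrable_on_def)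
  then have *: "((\<lambda>x. f x * (\<alpha> * (b - x) powr (\<alpha> - 1))) has_integral
      (LINT x:{a..b}|lebesgue. f x * (\<alpha> * (b - x) powr (\<alpha> - 1)))) {a..b}"
    by (rule has_integral_set_lebesgue)
  have "(LINT x:{a..b}|lebesgue. f x * (\<alpha> * (b - x) powr (\<alpha> - 1))) =
      (LINT x:{a..b}|lebesgue. \<alpha> * ((b - x) powr (\<alpha> - 1) * f x))"
    by (simp add: mult_ac)
  also have "\<dots> = \<alpha> * (LINT x:{a..b}|lebesgue. (b - x) powr (\<alpha> - 1) * f x)"
    by (rule set_integral_mult_right)
  also have "\<dots> = Gamma (\<alpha> + 1) * RL_integral_left \<alpha> a f b"
    using assms(2) Gamma_real_pos[OF assms(2), THEN less_imp_neq]
    by (simp add: RL_integral_left_def Gamma_plus1 nonpos_Ints_def)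
  finally show ?thesis using * by simp
qed

lemma RL_integral_right_has_integral:
  fixes f :: "real \<Rightarrow> real"
  assumes "a \<le> b" "0 < \<alpha>" "continuous_on {a..b} f"
  shows "((\<lambda>x. f x * (\<alpha> * (x - a) powr (\<alpha> - 1))) has_integral
           Gamma (\<alpha> + 1) * RL_integral_right \<alpha> b f a) {a..b}"
proof -
  have "(\<lambda>x. f x * (\<alpha> * (x - a) powr (\<alpha> - 1))) absolutely_integrable_on {a..b}"
    using has_integral_powr_from_left[OF assms(1,2)] assms
    by (intro absolutely_integrable_continuous_mult_nonneg) (auto simp: integrable_on_def)
  then have *: "((\<lambda>x. f x * (\<alpha> * (x - a) powr (\<alpha> - 1))) has_integral
      (LINT x:{a..b}|lebesgue. f x * (\<alpha> * (x - a) powr (\<alpha> - 1)))) {a..b}"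
    by (rule has_integral_set_lebesgue)
  have "(LINT x:{a..b}|lebesgue. f x * (\<alpha> * (x - a) powr (\<alpha> - 1))) =
      (LINT x:{a..b}|lebesgue. \<alpha> * ((x - a) powr (\<alpha> - 1) * f x))"
    by (simp add: mult_ac)
  also have "\<dots> = \<alpha> * (LINT x:{a..b}|lebesgue. (x - a) powr (\<alpha> - 1) * f x)"
    by (rule set_integral_mult_right)
  also have "\<dots> = Gamma (\<alpha> + 1) * RL_integral_right \<alpha> b f a"
    using assms(2) Gamma_real_pos[OF assms(2), THEN less_imp_neq]
    by (simp add: RL_integral_right_def Gamma_plus1 nonpos_Ints_def)
  finally show ?thesis using * by simp
qed

text \<open>
  Integration by parts. The fundamental theorem is applied to \<open>f g\<close> in the form that asks for
  differentiability in the interior only, because for \<open>\<alpha> < 1\<close> the weight \<open>g\<close> has infinite slope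
  at both ends.
\<close>

lemma has_integral_trapezoid_RL:
  fixes f f' :: "real \<Rightarrow> real"
  assumes "a < b" "0 < \<alpha>"
    and f: "\<And>x. x \<in> {a..b} \<Longrightarrow> (f has_real_derivative f' x) (at x within {a..b})"
  shows "((\<lambda>x. f' x * ((x - a) powr \<alpha> - (b - x) powr \<alpha>)) has_integral
           (b - a) powr \<alpha> * (f a + f b) -
             Gamma (\<alpha> + 1) * (RL_integral_left \<alpha> a f b + RL_integral_right \<alpha> b f a)) {a..b}"
proof -
  define g where "g x = (x - a) powr \<alpha> - (b - x) powr \<alpha>" for x
  define g' where "g' x = \<alpha> * (b - x) powr (\<alpha> - 1) + \<alpha> * (x - a) powr (\<alpha> - 1)" for x
  have cf: "continuous_on {a..b} f"
    using f by (meson DERIV_continuous_on)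
  have cg: "continuous_on {a..b} g"
    unfolding g_def using assms by (auto intro!: continuous_intros continuous_on_powr')
  have "((\<lambda>x. f' x * g x + f x * g' x) has_integral f b * g b - f a * g a) {a..b}"
  proof (rule fundamental_theorem_of_calculus_interior)
    fix x assume x: "x \<in> {a<..<b}"
    then have "(f has_real_derivative f' x) (at x)"
      using f[of x] by (simp add: at_within_Icc_at)
    moreover have "(g has_real_derivative g' x) (at x)"
      unfolding g_def g'_def using x by (auto intro!: derivative_eq_intros)
    ultimately show "((\<lambda>x. f x * g x) has_vector_derivative f' x * g x + f x * g' x) (at x)"
      unfolding has_real_derivative_iff_has_vector_derivative[symmetric]
      by (auto intro!: derivative_eq_intros)
  qed (use assms cf cg in \<open>auto intro!: continuous_intros\<close>)
  moreover have "((\<lambda>x. f x * g' x) has_integral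
      Gamma (\<alpha> + 1) * RL_integral_left \<alpha> a f b + Gamma (\<alpha> + 1) * RL_integral_right \<alpha> b f a) {a..b}"
    unfolding g'_def distrib_left[of "f _"] using assms cf
    by (intro has_integral_add RL_integral_left_has_integral RL_integral_right_has_integral) auto
  ultimately have "((\<lambda>x. f' x * g x + f x * g' x - f x * g' x) has_integral
      f b * g b - f a * g a -
      (Gamma (\<alpha> + 1) * RL_integral_left \<alpha> a f b + Gamma (\<alpha> + 1) * RL_integral_right \<alpha> b f a)) {a..b}"
    by (rule has_integral_diff)
  then show ?thesis
    by (simp add: g_def algebra_simps)
qed

section \<open>The power-mean inequality in linearised form\<close>

text \<open>
  Weighted arithmetic-geometric mean of \<open>m\<close> and \<open>m\<^bsup>1-q\<^esup> y\<^sup>q\<close>: the exponents of \<open>m\<close> cancel in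
  the geometric mean. Geometrically, the graph of \<open>z \<mapsto> z\<^bsup>1/q\<^esup>\<close> lies below its tangent at \<open>z = m\<^sup>q\<close>.
\<close>

lemma powr_tangent_bound:
  fixes y m q :: real
  assumes "0 \<le> y" "0 < m" "1 \<le> q"
  shows "y \<le> (1 - 1 / q) * m + 1 / q * (m powr (1 - q) * y powr q)"
proof (cases "y = 0")
  case True
  with assms show ?thesis by simp
next
  case False
  with assms have "y > 0" by simp
  have "m powr (1 - 1 / q) * (m powr (1 - q) * y powr q) powr (1 / q)
      \<le> (1 - 1 / q) * m + 1 / q * (m powr (1 - q) * y powr q)"
    using assms \<open>y > 0\<close> by (intro Youngs_inequality_0) auto
  moreover have "(m powr (1 - q) * y powr q) powr (1 / q) = m powr ((1 - q) / q) * y"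
    using assms \<open>y > 0\<close> by (simp add: powr_mult powr_powr)
  moreover have "m powr (1 - 1 / q) * m powr ((1 - q) / q) = 1"
    using assms by (simp add: diff_divide_distrib flip: powr_add)
  ultimately show ?thesis
    by (simp flip: mult.assoc)
qed

text \<open>
  Minimising the right-hand side over \<open>m\<close>: the minimiser \<open>m = (V / W)\<^bsup>1/q\<^esup>\<close> makes both terms
  multiples of \<open>W\<^bsup>1-1/q\<^esup> V\<^bsup>1/q\<^esup>\<close>. It is not positive when \<open>V = 0\<close>; then the bound \<open>0\<close> results
  from letting \<open>m\<close> tend to \<open>0\<close>.
\<close>

lemma powr_mean_from_linear_bounds:
  fixes I V W q :: real
  assumes "0 < W" "0 \<le> V" "1 \<le> q"
    and I: "\<And>m. 0 < m \<Longrightarrow> I \<le> (1 - 1 / q) * m * W + 1 / q * m powr (1 - q) * V"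
  shows "I \<le> W powr ((q - 1) / q) * V powr (1 / q)"
proof (cases "V = 0")
  case True
  have "I \<le> e" if "0 < e" for e
  proof -
    have "I \<le> (1 - 1 / q) * (e / W) * W"
      using I[of "e / W"] that \<open>0 < W\<close> True by simp
    also have "\<dots> = (1 - 1 / q) * e" using \<open>0 < W\<close> by simp
    also have "\<dots> \<le> 1 * e" using assms that by (intro mult_right_mono) auto
    finally show ?thesis by simp
  qed
  then have "I \<le> 0" by (rule field_le_epsilon[of I 0, simplified])
  with True show ?thesis by simp
next
  case False
  with assms have "0 < V" by simp
  define m where "m = V powr (1 / q) * W powr (- 1 / q)"
  define P where "P = W powr ((q - 1) / q) * V powr (1 / q)"
  have "m > 0" using \<open>0 < V\<close> \<open>0 < W\<close> by (simp add: m_def)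
  have "m * W = V powr (1 / q) * (W powr (- 1 / q) * W powr 1)"
    using \<open>0 < W\<close> by (simp add: m_def)
  also have "W powr (- 1 / q) * W powr 1 = W powr ((q - 1) / q)"
    unfolding powr_add[symmetric] using assms by (simp add: field_simps)
  finally have mW: "m * W = P" by (simp add: P_def mult_ac)
  have "- 1 / q * (1 - q) = (q - 1) / q" "1 / q * (1 - q) = (1 - q) / q"
    by (simp_all add: diff_divide_distrib)
  then have "m powr (1 - q) = V powr ((1 - q) / q) * W powr ((q - 1) / q)"
    by (simp only: m_def powr_mult powr_powr powr_ge_zero)
  then have "m powr (1 - q) * V = (V powr ((1 - q) / q) * V powr 1) * W powr ((q - 1) / q)"
    using \<open>0 < V\<close> by simp
  also have "V powr ((1 - q) / q) * V powr 1 = V powr (1 / q)"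
    unfolding powr_add[symmetric] using assms by (simp add: field_simps)
  finally have mV: "m powr (1 - q) * V = P" by (simp add: P_def mult_ac)
  have "I \<le> (1 - 1 / q) * (m * W) + 1 / q * (m powr (1 - q) * V)"
    using I[OF \<open>m > 0\<close>] by (simp only: mult.assoc)
  also have "\<dots> = P" unfolding mW mV by (simp add: algebra_simps)
  finally show ?thesis by (simp add: P_def)
qed

section \<open>Integrals against the symmetric kernel\<close>

lemma has_integral_fold_unit_interval:
  fixes F :: "real \<Rightarrow> real"
  assumes F: "F integrable_on {0..1}"
    and J: "((\<lambda>u. F u + F (1 - u)) has_integral J) {0..1/2}"
  shows "(F has_integral J) {0..1}"
proof -
  obtain I1 where I1: "(F has_integral I1) {0..1/2}"
    using integrable_subinterval_real[OF F, of 0 "1/2"] by (auto simp: integrable_on_def)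
  obtain I2 where I2: "(F has_integral I2) {1/2..1}"
    using integrable_subinterval_real[OF F, of "1/2" 1] by (auto simp: integrable_on_def)
  have "((\<lambda>u. F (1 - u)) has_integral I2) {0..1/2}"
  proof -
    have "(\<lambda>x::real. 1 - x) ` {1/2..1} = {0..1/2}"
      by simp
    then show ?thesis
      using has_integral_affinity[of F I2 "1/2" 1 "-1" 1] I2 by simp
  qed
  with I1 have "((\<lambda>u. F u + F (1 - u)) has_integral I1 + I2) {0..1/2}"
    by (rule has_integral_add)
  with J have "J = I1 + I2" by (rule has_integral_unique)
  with has_integral_combine[OF _ _ I1 I2] show ?thesis by simp
qed

text \<open>
  The kernel takes the same value at \<open>u\<close> and \<open>1 - u\<close>, and on \<open>[0, 1/2]\<close> its sign is known. Only the
  symmetrisation \<open>p u + p (1 - u)\<close> of the other factor survives the folding.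
\<close>

lemma has_integral_symmetric_kernel:
  fixes p :: "real \<Rightarrow> real"
  assumes "0 < \<alpha>" "continuous_on {0..1} p"
    and J: "((\<lambda>u. ((1 - u) powr \<alpha> - u powr \<alpha>) * (p u + p (1 - u))) has_integral J) {0..1/2}"
  shows "((\<lambda>u. \<bar>u powr \<alpha> - (1 - u) powr \<alpha>\<bar> * p u) has_integral J) {0..1}"
proof (rule has_integral_fold_unit_interval)
  show "(\<lambda>u. \<bar>u powr \<alpha> - (1 - u) powr \<alpha>\<bar> * p u) integrable_on {0..1}"
    using assms(1,2)
    by (intro integrable_continuous_real) (auto intro!: continuous_intros continuous_on_powr')
  show "((\<lambda>u. \<bar>u powr \<alpha> - (1 - u) powr \<alpha>\<bar> * p u +
      \<bar>(1 - u) powr \<alpha> - (1 - (1 - u)) powr \<alpha>\<bar> * p (1 - u)) has_integral J) {0..1/2}"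
  proof (rule has_integral_eq[OF _ J])
    fix u :: real assume "u \<in> {0..1/2}"
    then have "u powr \<alpha> \<le> (1 - u) powr \<alpha>"
      using \<open>0 < \<alpha>\<close> by (intro powr_mono2) auto
    then show "((1 - u) powr \<alpha> - u powr \<alpha>) * (p u + p (1 - u)) =
        \<bar>u powr \<alpha> - (1 - u) powr \<alpha>\<bar> * p u + \<bar>(1 - u) powr \<alpha> - (1 - (1 - u)) powr \<alpha>\<bar> * p (1 - u)"
      by (simp add: algebra_simps)
  qed
qed

lemma has_integral_incomplete_Beta_half:
  assumes "1 < x" "1 < y"
  shows "((\<lambda>t. t powr (x - 1) * (1 - t) powr (y - 1)) has_integral incomplete_Beta (1/2) x y) {0..1/2}"
  unfolding incomplete_Beta_def using assms
  by (intro has_integral_set_lebesgue absolutely_integrable_continuous_real)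
     (auto intro!: continuous_intros continuous_on_powr')

lemma has_integral_powr_diff_half:
  fixes r :: real
  assumes "0 < r"
  shows "((\<lambda>u. (1 - u) powr r - u powr r) has_integral (1 - 1 / 2 powr r) / (r + 1)) {0..1/2::real}"
proof -
  have "((\<lambda>u. (r + 1) * ((1 - u) powr r - u powr r)) has_integral
      - ((1 - 1/2) powr (r + 1) + (1/2) powr (r + 1)) -
      - ((1 - 0) powr (r + 1) + 0 powr (r + 1))) {0..1/2::real}"
  proof (rule fundamental_theorem_of_calculus_interior)
    fix x :: real assume "x \<in> {0<..<1/2}"
    then show "((\<lambda>u. - ((1 - u) powr (r + 1) + u powr (r + 1))) has_vector_derivative
        (r + 1) * ((1 - x) powr r - x powr r)) (at x)"
      unfolding has_real_derivative_iff_has_vector_derivative[symmetric]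
      by (auto intro!: derivative_eq_intros simp: right_diff_distrib)
  qed (use assms in \<open>auto intro!: continuous_intros continuous_on_powr'\<close>)
  moreover have "(1/2::real) powr (r + 1) = 1 / 2 powr r / 2"
    by (simp add: powr_add powr_divide)
  ultimately have "((\<lambda>u. (r + 1) * ((1 - u) powr r - u powr r)) has_integral 1 - 1 / 2 powr r) {0..1/2}"
    by simp
  from has_integral_divide[OF this, of "r + 1"] show ?thesis
    using assms by simp
qed

lemma has_integral_symmetric_kernel_mass:
  fixes \<alpha> :: real
  assumes "0 < \<alpha>"
  shows "((\<lambda>u. \<bar>u powr \<alpha> - (1 - u) powr \<alpha>\<bar>) has_integral 2 / (\<alpha> + 1) * (1 - 1 / 2 powr \<alpha>)) {0..1}"
proof -
  have "((\<lambda>u. ((1 - u) powr \<alpha> - u powr \<alpha>) * 2) has_integral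
      (1 - 1 / 2 powr \<alpha>) / (\<alpha> + 1) * 2) {0..1/2}"
    by (intro has_integral_mult_left has_integral_powr_diff_half assms)
  then show ?thesis
    using has_integral_symmetric_kernel[of \<alpha> "\<lambda>_. 1"] assms by (simp add: mult.commute)
qed

text \<open>
  On \<open>[0, 1/2]\<close> the folded integrand \<open>((1 - u)\<^sup>\<alpha> - u\<^sup>\<alpha>) (u\<^sup>s + (1 - u)\<^sup>s)\<close> expands into two mixed
  products, the Beta integrands, and the difference \<open>(1 - u)\<^bsup>\<alpha>+s\<^esup> - u\<^bsup>\<alpha>+s\<^esup>\<close>.
\<close>

lemma has_integral_kernel_s_convex_bound:
  fixes \<alpha> s A B :: real
  assumes "0 < \<alpha>" "0 < s"
  shows "((\<lambda>u. \<bar>u powr \<alpha> - (1 - u) powr \<alpha>\<bar> * (u powr s * B + (1 - u) powr s * A)) has_integral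
           (incomplete_Beta (1/2) (s + 1) (\<alpha> + 1) - incomplete_Beta (1/2) (\<alpha> + 1) (s + 1) +
            (2 powr (\<alpha> + s) - 1) / ((\<alpha> + s + 1) * 2 powr (\<alpha> + s))) * (A + B)) {0..1}"
    (is "(_ has_integral ?K * _) _")
proof (rule has_integral_symmetric_kernel)
  show "continuous_on {0..1} (\<lambda>u. u powr s * B + (1 - u) powr s * A)"
    using assms by (auto intro!: continuous_intros continuous_on_powr')
  have "(1 - 1 / 2 powr (\<alpha> + s)) / (\<alpha> + s + 1) =
      (2 powr (\<alpha> + s) - 1) / ((\<alpha> + s + 1) * 2 powr (\<alpha> + s))"
    using assms by (simp add: divide_simps)
  then have "((\<lambda>u. u powr s * (1 - u) powr \<alpha> - u powr \<alpha> * (1 - u) powr s +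
      ((1 - u) powr (\<alpha> + s) - u powr (\<alpha> + s))) has_integral ?K) {0..1/2}"
    using has_integral_add[OF has_integral_diff[OF
        has_integral_incomplete_Beta_half[of "s + 1" "\<alpha> + 1"]
        has_integral_incomplete_Beta_half[of "\<alpha> + 1" "s + 1"]]
        has_integral_powr_diff_half[of "\<alpha> + s"]] assms
    by simp
  then have "((\<lambda>u. (u powr s * (1 - u) powr \<alpha> - u powr \<alpha> * (1 - u) powr s +
      ((1 - u) powr (\<alpha> + s) - u powr (\<alpha> + s))) * (A + B)) has_integral ?K * (A + B)) {0..1/2}"
    by (rule has_integral_mult_left)
  then show "((\<lambda>u. ((1 - u) powr \<alpha> - u powr \<alpha>) * (u powr s * B + (1 - u) powr s * A +
      ((1 - u) powr s * B + (1 - (1 - u)) powr s * A))) has_integral ?K * (A + B)) {0..1/2}"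
    by (rule has_integral_eq[rotated]) (simp add: powr_add algebra_simps)
qed (use assms in auto)

section \<open>The trapezoidal inequality\<close>

theorem theorem4:
  fixes a b \<alpha> s q :: real and f f' :: "real \<Rightarrow> real"
  assumes "0 \<le> a" and "a < b" and "0 < \<alpha>"
    and "0 < s" and "s < 1" and "1 \<le> q"
    and "\<And>x. x \<in> {a..b} \<Longrightarrow> (f has_real_derivative f' x) (at x within {a..b})"
    and "f' absolutely_integrable_on {a..b}"
    and "s_convex_on s {a..b} (\<lambda>x. \<bar>f' x\<bar> powr q)"
  shows "\<bar>(f a + f b) / 2 -
           Gamma (\<alpha> + 1) / (2 * (b - a) powr \<alpha>) *
             (RL_integral_left \<alpha> a f b + RL_integral_right \<alpha> b f a)\<bar>
         \<le> (b - a) / 2 *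
            (2 / (\<alpha> + 1) * (1 - 1 / 2 powr \<alpha>)) powr ((q - 1) / q) *
            (incomplete_Beta (1/2) (s + 1) (\<alpha> + 1) - incomplete_Beta (1/2) (\<alpha> + 1) (s + 1) +
             (2 powr (\<alpha> + s) - 1) / ((\<alpha> + s + 1) * 2 powr (\<alpha> + s))) powr (1 / q) *
            (\<bar>f' a\<bar> powr q + \<bar>f' b\<bar> powr q) powr (1 / q)"
proof -
  define c where "c = b - a"
  define A where "A = \<bar>f' a\<bar> powr q"
  define B where "B = \<bar>f' b\<bar> powr q"
  define W where "W = 2 / (\<alpha> + 1) * (1 - 1 / 2 powr \<alpha>)"
  define K where "K = incomplete_Beta (1/2) (s + 1) (\<alpha> + 1) - incomplete_Beta (1/2) (\<alpha> + 1) (s + 1) +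
             (2 powr (\<alpha> + s) - 1) / ((\<alpha> + s + 1) * 2 powr (\<alpha> + s))"
  define k where "k u = \<bar>u powr \<alpha> - (1 - u) powr \<alpha>\<bar>" for u :: real
  define h where "h u = u powr s * B + (1 - u) powr s * A" for u
  define g where "g x = (x - a) powr \<alpha> - (b - x) powr \<alpha>" for x
  define D where "D = c powr \<alpha> * (f a + f b) -
             Gamma (\<alpha> + 1) * (RL_integral_left \<alpha> a f b + RL_integral_right \<alpha> b f a)"
  have "c > 0" using \<open>a < b\<close> by (simp add: c_def)
  have D: "((\<lambda>x. f' x * g x) has_integral D) {a..b}"
    unfolding D_def g_def c_def using assms by (intro has_integral_trapezoid_RL) auto
  have W: "(k has_integral W) {0..1}"
    unfolding k_def W_def using \<open>0 < \<alpha>\<close> by (rule has_integral_symmetric_kernel_mass)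
  have V: "((\<lambda>u. k u * h u) has_integral K * (A + B)) {0..1}"
    unfolding k_def h_def K_def using \<open>0 < \<alpha>\<close> \<open>0 < s\<close> by (rule has_integral_kernel_s_convex_bound)
  have "W > 0"
    unfolding W_def using \<open>0 < \<alpha>\<close> by (intro mult_pos_pos) auto
  have "0 \<le> A" "0 \<le> B" by (simp_all add: A_def B_def)
  \<comment> \<open>Taking the coefficients 1 and 0 exhibits K itself as the integral of a nonnegative function.\<close>
  have "0 \<le> K"
  proof (rule has_integral_nonneg)
    show "((\<lambda>u. k u * (u powr s * 1 + (1 - u) powr s * 0)) has_integral K) {0..1}"
      using has_integral_kernel_s_convex_bound[OF \<open>0 < \<alpha>\<close> \<open>0 < s\<close>, of 1 0]
      by (simp add: k_def K_def)
  qed (simp add: k_def)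
  then have "0 \<le> K * (A + B)"
    using \<open>0 \<le> A\<close> \<open>0 \<le> B\<close> by simp

  have g_eq: "\<bar>g x\<bar> = c powr \<alpha> * k ((x - a) / c)" if "x \<in> {a..b}" for x
  proof -
    have "1 - (x - a) / c = (b - x) / c" using \<open>c > 0\<close> by (simp add: c_def field_simps)
    then have "k ((x - a) / c) = \<bar>(x - a) powr \<alpha> / c powr \<alpha> - (b - x) powr \<alpha> / c powr \<alpha>\<bar>"
      using that \<open>c > 0\<close> by (simp add: k_def powr_divide)
    also have "\<dots> = \<bar>g x\<bar> / c powr \<alpha>"
      by (simp add: g_def flip: diff_divide_distrib)
    finally show ?thesis using \<open>c > 0\<close> by simp
  qed
  have f'_le: "\<bar>f' x\<bar> powr q \<le> h ((x - a) / c)" if "x \<in> {a..b}" for x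
  proof -
    define u where "u = (x - a) / c"
    have "u \<in> {0..1}" using that \<open>c > 0\<close> by (simp add: u_def c_def)
    moreover have "u * b + (1 - u) * a = x"
    proof -
      have "u * c = x - a" using \<open>c > 0\<close> by (simp add: u_def)
      then show ?thesis by (simp add: c_def algebra_simps)
    qed
    ultimately show ?thesis
      using assms(9) \<open>a < b\<close> unfolding s_convex_on_def h_def A_def B_def u_def[symmetric]
      by (metis atLeastAtMost_iff less_imp_le order_refl)
  qed

  \<comment> \<open>In the power of c, \<open>\<alpha>\<close> comes from the homogeneity of g and 1 from the substitution.\<close>
  have "\<bar>D\<bar> / c powr (\<alpha> + 1) \<le> W powr ((q - 1) / q) * (K * (A + B)) powr (1 / q)"
  proof (rule powr_mean_from_linear_bounds)
    fix m :: real assume "0 < m"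
    define E where "E = (1 - 1 / q) * m * W + 1 / q * m powr (1 - q) * (K * (A + B))"
    define e where "e u = (1 - 1 / q) * m * k u + 1 / q * m powr (1 - q) * (k u * h u)" for u
    have "(e has_integral E) {0..1}"
      unfolding e_def E_def by (intro has_integral_add has_integral_mult_right W V)
    then have "((\<lambda>x. e (1 / c * x + - a / c)) has_integral c * E) {a..a + c}"
      using has_integral_affinity'[of e E 0 1 "1 / c" "- a / c"] \<open>c > 0\<close>
      by (simp add: distrib_left mult.commute add.commute)
    moreover have "1 / c * x + - a / c = (x - a) / c" for x
      by (simp add: diff_divide_distrib)
    ultimately have "((\<lambda>x. e ((x - a) / c)) has_integral c * E) {a..b}"
      by (simp only: c_def add_diff_cancel_left' diff_add_cancel add_diff_eq)
    then have e_int: "((\<lambda>x. c powr \<alpha> * e ((x - a) / c)) has_integral c powr \<alpha> * (c * E)) {a..b}"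
      by (rule has_integral_mult_right)
    have "norm (integral {a..b} (\<lambda>x. f' x * g x))
        \<le> integral {a..b} (\<lambda>x. c powr \<alpha> * e ((x - a) / c))"
    proof (rule integral_norm_bound_integral)
      fix x assume x: "x \<in> {a..b}"
      let ?u = "(x - a) / c"
      have "\<bar>f' x\<bar> \<le> (1 - 1 / q) * m + 1 / q * (m powr (1 - q) * \<bar>f' x\<bar> powr q)"
        using \<open>0 < m\<close> \<open>1 \<le> q\<close> by (intro powr_tangent_bound) auto
      also have "\<dots> \<le> (1 - 1 / q) * m + 1 / q * (m powr (1 - q) * h ?u)"
        using f'_le[OF x] \<open>1 \<le> q\<close> by (intro add_left_mono mult_left_mono) auto
      finally have "\<bar>f' x\<bar> * \<bar>g x\<bar> \<le>
          ((1 - 1 / q) * m + 1 / q * (m powr (1 - q) * h ?u)) * \<bar>g x\<bar>"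
        by (rule mult_right_mono) simp
      also have "\<dots> = c powr \<alpha> * e ?u"
        unfolding g_eq[OF x] e_def by (simp add: algebra_simps)
      finally show "norm (f' x * g x) \<le> c powr \<alpha> * e ?u" by (simp add: abs_mult)
    qed (use D e_int in auto)
    then have "\<bar>D\<bar> \<le> c powr \<alpha> * (c * E)"
      unfolding integral_unique[OF D] integral_unique[OF e_int] by simp
    also have "\<dots> = E * c powr (\<alpha> + 1)"
      using \<open>c > 0\<close> by (simp add: powr_add mult_ac)
    finally show "\<bar>D\<bar> / c powr (\<alpha> + 1) \<le>
        (1 - 1 / q) * m * W + 1 / q * m powr (1 - q) * (K * (A + B))"
      using \<open>c > 0\<close> by (simp add: E_def divide_le_eq)
  qed (use \<open>W > 0\<close> \<open>0 \<le> K * (A + B)\<close> \<open>1 \<le> q\<close> in auto)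
  then have "c / 2 * (\<bar>D\<bar> / c powr (\<alpha> + 1)) \<le>
      c / 2 * (W powr ((q - 1) / q) * (K * (A + B)) powr (1 / q))"
    using \<open>c > 0\<close> by (intro mult_left_mono) auto
  also have "(K * (A + B)) powr (1 / q) = K powr (1 / q) * (A + B) powr (1 / q)"
    using \<open>0 \<le> K\<close> \<open>0 \<le> A\<close> \<open>0 \<le> B\<close> by (intro powr_mult)
  also have "c / 2 * (\<bar>D\<bar> / c powr (\<alpha> + 1)) = \<bar>D / (2 * c powr \<alpha>)\<bar>"
    using \<open>c > 0\<close> by (simp add: powr_add)
  also have "D / (2 * c powr \<alpha>) = (f a + f b) / 2 - Gamma (\<alpha> + 1) / (2 * c powr \<alpha>) *
      (RL_integral_left \<alpha> a f b + RL_integral_right \<alpha> b f a)"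
    using \<open>c > 0\<close> by (simp add: D_def field_simps)
  finally show ?thesis
    by (simp only: c_def W_def K_def A_def B_def mult.assoc)
qed

end
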